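(* Let $K$ be a field of arbitrary characteristic and $S=K[x_i:i\in\mathbb{N}]$. Every Borel fixed monomial space $V\subset S$ is block stable.
   Context: $\mathbb{N}=\{0,1,2,\ldots\}$. A monomial space $V\subset S$ is a $K$-vector subspace having a $K$-basis consisting of monomials. Consider the group of $\infty\times\infty$ upper triangular matrices $g=(g_{ij})_{i,j\in\mathbb{N}}$ with entries in $K$ and $1$'s on the diagonal, acting on $S$ by $K$-algebra automorphisms via $x_j\mapsto x_j+\sum_{i<j}g_{ij}x_i$. A monomial space is Borel fixed if it is mapped to itself by every element of this group. A monomial space $V\subset S$ is block stable if for any monomial $u=x_0^{a_0}\cdots x_e^{a_e}\in V$ and any $i=1,\ldots,e$ one has $$\frac{u}{x_i^{a_i}\cdots x_e^{a_e}}\cdot x_{i-1}^{a_i}\cdots x_{e-1}^{a_e}\in V.$$ *)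

theory Defs
  imports Complex_Main "HOL-Library.Poly_Mapping"
begin

text \<open>
  The ring \<open>K[x\<^sub>i : i \<in> \<nat>]\<close>: finitely supported functions from exponent vectors
  (themselves finitely supported) to coefficients, multiplied by convolution.
\<close>

type_synonym 'k infpoly = "(nat \<Rightarrow>\<^sub>0 nat) \<Rightarrow>\<^sub>0 'k"

definition Const :: "'k \<Rightarrow> 'k::comm_ring_1 infpoly" where
  "Const c = Poly_Mapping.single 0 c"

definition Var :: "nat \<Rightarrow> 'k::comm_ring_1 infpoly" where
  "Var j = Poly_Mapping.single (Poly_Mapping.single j 1) 1"

definition scale :: "'k \<Rightarrow> 'k::comm_ring_1 infpoly \<Rightarrow> 'k infpoly" where
  "scale c p = Const c * p"

interpretation infpoly: vector_space "scale :: 'k::field \<Rightarrow> 'k infpoly \<Rightarrow> 'k infpoly"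
  by unfold_locales
    (simp_all add: scale_def Const_def algebra_simps single_add mult_single
      flip: mult.assoc)

definition monomials :: "'k::comm_ring_1 infpoly set" where
  "monomials = range (\<lambda>m. Poly_Mapping.single m 1)"

definition monomial_space :: "'k::field infpoly set \<Rightarrow> bool" where
  "monomial_space V \<longleftrightarrow>
    infpoly.subspace V \<and>
    (\<exists>B \<subseteq> monomials. infpoly.independent B \<and> infpoly.span B = V)"

text \<open>The \<open>K\<close>-algebra endomorphism sending each \<open>x\<^sub>j\<close> to \<open>s j\<close>.\<close>

definition subst :: "(nat \<Rightarrow> 'k::comm_ring_1 infpoly) \<Rightarrow> 'k infpoly \<Rightarrow> 'k infpoly" where
  "subst s p = (\<Sum>m\<in>Poly_Mapping.keys p. scale (Poly_Mapping.lookup p m)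
      (\<Prod>j\<in>Poly_Mapping.keys m. s j ^ Poly_Mapping.lookup m j))"

definition upper_unitriangular :: "(nat \<Rightarrow> nat \<Rightarrow> 'k::comm_ring_1) \<Rightarrow> bool" where
  "upper_unitriangular g \<longleftrightarrow> (\<forall>i. g i i = 1) \<and> (\<forall>i j. j < i \<longrightarrow> g i j = 0)"

definition act :: "(nat \<Rightarrow> nat \<Rightarrow> 'k::comm_ring_1) \<Rightarrow> 'k infpoly \<Rightarrow> 'k infpoly" where
  "act g = subst (\<lambda>j. Var j + (\<Sum>i<j. scale (g i j) (Var i)))"

definition borel_fixed :: "'k::comm_ring_1 infpoly set \<Rightarrow> bool" where
  "borel_fixed V \<longleftrightarrow> (\<forall>g. upper_unitriangular g \<longrightarrow> act g ` V = V)"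

text \<open>
  The quotient of \<open>u = x\<^sub>0^a\<^sub>0 \<cdots> x\<^sub>e^a\<^sub>e\<close> by \<open>x\<^sub>i^a\<^sub>i \<cdots> x\<^sub>e^a\<^sub>e\<close> is written as the product over
  \<open>k < i\<close>. Exponents, including \<open>a\<^sub>e\<close>, may be zero.
\<close>

definition block_stable :: "'k::comm_ring_1 infpoly set \<Rightarrow> bool" where
  "block_stable V \<longleftrightarrow>
    (\<forall>(a :: nat \<Rightarrow> nat) e. (\<Prod>k\<le>e. Var k ^ a k) \<in> V \<longrightarrow>
      (\<forall>i\<in>{1..e}. (\<Prod>k<i. Var k ^ a k) * (\<Prod>k=i..e. Var (k - 1) ^ a k) \<in> V))"

lemma Const_mult: "Const (a * b) = Const a * Const b"
  by (simp add: Const_def mult_single)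

lemma Const_add: "Const (a + b) = Const a + Const b"
  by (simp add: Const_def single_add)

lemma Const_0 [simp]: "Const 0 = 0"
  by (simp add: Const_def)

lemma Const_1 [simp]: "Const 1 = 1"
  by (simp add: Const_def)

lemma prod_Var: "(\<Prod>k\<in>A. Var k ^ a k) = Poly_Mapping.single (\<Sum>k\<in>A. Poly_Mapping.single k (a k)) 1"
proof -
  have pow: "Var k ^ n = Poly_Mapping.single (Poly_Mapping.single k n) 1" for k n
    by (induction n) (simp_all add: Var_def mult_single flip: single_add)
  show ?thesis
    by (induction A rule: infinite_finite_induct) (simp_all add: pow mult_single)
qed

lemma infpoly_eq_sum_keys: "(\<Sum>m\<in>Poly_Mapping.keys p. Poly_Mapping.single m (Poly_Mapping.lookup p m)) = p"
proof (rule poly_mapping_eqI)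
  fix k
  show "Poly_Mapping.lookup (\<Sum>m\<in>Poly_Mapping.keys p. Poly_Mapping.single m (Poly_Mapping.lookup p m)) k
      = Poly_Mapping.lookup p k"
    by (simp add: lookup_sum lookup_single when_def in_keys_iff)
qed

lemma subst_superset:
  assumes "finite A" "Poly_Mapping.keys p \<subseteq> A"
  shows "subst s p = (\<Sum>m\<in>A. scale (Poly_Mapping.lookup p m)
      (\<Prod>j\<in>Poly_Mapping.keys m. s j ^ Poly_Mapping.lookup m j))"
  unfolding subst_def using assms
  by (intro sum.mono_neutral_left) (auto simp: in_keys_iff scale_def)

lemma subst_add: "subst s (p + q) = subst s p + subst s q"
proof -
  let ?A = "Poly_Mapping.keys p \<union> Poly_Mapping.keys q"
  have "Poly_Mapping.keys (p + q) \<subseteq> ?A" by (rule keys_add)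
  then show ?thesis
    by (simp add: subst_superset[of ?A] lookup_add scale_def Const_add distrib_right sum.distrib)
qed

lemma subst_0 [simp]: "subst s 0 = 0"
  by (simp add: subst_def)

lemma subst_sum: "subst s (sum f A) = (\<Sum>x\<in>A. subst s (f x))"
  by (induction A rule: infinite_finite_induct) (simp_all add: subst_add)

lemma subst_single: "subst s (Poly_Mapping.single m c) =
    Const c * (\<Prod>j\<in>Poly_Mapping.keys m. s j ^ Poly_Mapping.lookup m j)"
  by (simp add: subst_def scale_def)

lemma prod_exponents_add:
  fixes s :: "nat \<Rightarrow> 'k::comm_ring_1 infpoly"
  shows "(\<Prod>j\<in>Poly_Mapping.keys (m + n). s j ^ Poly_Mapping.lookup (m + n) j) =
    (\<Prod>j\<in>Poly_Mapping.keys m. s j ^ Poly_Mapping.lookup m j) *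
    (\<Prod>j\<in>Poly_Mapping.keys n. s j ^ Poly_Mapping.lookup n j)"
proof -
  let ?A = "Poly_Mapping.keys m \<union> Poly_Mapping.keys n"
  have *: "(\<Prod>j\<in>Poly_Mapping.keys l. s j ^ Poly_Mapping.lookup l j) =
      (\<Prod>j\<in>?A. s j ^ Poly_Mapping.lookup l j)" if "Poly_Mapping.keys l \<subseteq> ?A" for l
    using that by (intro prod.mono_neutral_left) (auto simp: in_keys_iff)
  show ?thesis
    unfolding *[OF keys_add] *[of m, OF Un_upper1] *[of n, OF Un_upper2]
    by (simp add: lookup_add power_add prod.distrib)
qed

lemma subst_mult: "subst s (p * q) = subst s p * subst s q"
proof -
  have single: "subst s (Poly_Mapping.single m c * Poly_Mapping.single n d) =
      subst s (Poly_Mapping.single m c) * subst s (Poly_Mapping.single n d)" for m n c d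
    by (simp add: mult_single subst_single prod_exponents_add Const_mult mult_ac)
  let ?t = "\<lambda>p m. Poly_Mapping.single m (Poly_Mapping.lookup p m)"
  have "subst s ((\<Sum>m\<in>Poly_Mapping.keys p. ?t p m) * (\<Sum>n\<in>Poly_Mapping.keys q. ?t q n)) =
      subst s (\<Sum>m\<in>Poly_Mapping.keys p. ?t p m) * subst s (\<Sum>n\<in>Poly_Mapping.keys q. ?t q n)"
    by (simp add: sum_product subst_sum single)
  then show ?thesis by (simp add: infpoly_eq_sum_keys)
qed

lemma subst_Const [simp]: "subst s (Const c) = Const c"
  using subst_single[of s 0 c] by (simp add: Const_def)

lemma subst_scale: "subst s (scale c p) = scale c (subst s p)"
  by (simp add: scale_def subst_mult)

lemma subst_Var [simp]: "subst s (Var j) = s j"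
  by (simp add: Var_def subst_single)

lemma act_Var: "act g (Var j) = Var j + (\<Sum>i<j. scale (g i j) (Var i))"
  by (simp add: act_def)

end

theory Submission
  imports Defs
begin

text \<open>
  Given \<open>u = x\<^sub>0^a\<^sub>0 \<cdots> x\<^sub>e^a\<^sub>e \<in> V\<close> and \<open>i \<ge> 1\<close>, let \<open>g\<close> act by \<open>x\<^sub>k \<mapsto> x\<^sub>k + x\<^bsub>k-1\<^esub>\<close> for \<open>k \<ge> i\<close> and fix
  the other variables. An element of a monomial space has all of its monomials
  in that space (\<open>monomial_space_contains_monomials\<close>), so it suffices that the desired monomial
  occurs in \<open>g u\<close> with nonzero coefficient. Binomial coefficients, which may vanish in \<open>K\<close>, do
  not interfere: grade monomials by giving \<open>x\<^sub>k\<close> weight \<open>k\<close>. The form \<open>x\<^sub>k + x\<^bsub>k-1\<^esub>\<close> has the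
  unique monomial \<open>x\<^bsub>k-1\<^esub>\<close> of least weight, with coefficient 1, and this property is
  multiplicative (\<open>lowest_mult\<close>). Hence the unique monomial of least weight in \<open>g u\<close> is obtained
  by replacing every \<open>x\<^sub>k\<close> with \<open>k \<ge> i\<close> by \<open>x\<^bsub>k-1\<^esub>\<close>, and its coefficient is 1 in every
  characteristic.
\<close>

definition weight :: "(nat \<Rightarrow>\<^sub>0 nat) \<Rightarrow> nat" where
  "weight m = (\<Sum>k\<in>Poly_Mapping.keys m. k * Poly_Mapping.lookup m k)"

lemma weight_add: "weight (m + n) = weight m + weight n"
  unfolding weight_def by (rule setsum_keys_plus_distrib) (simp_all add: distrib_left)

lemma weight_single [simp]: "weight (Poly_Mapping.single k c) = k * c"
  by (simp add: weight_def)

text \<open>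
  The lowest term is carried as a polynomial \<open>q\<close> rather than as an exponent vector, so that
  products of variables need not be converted to exponents. Requiring strictly larger weight
  in \<open>p - q\<close> also forces the coefficient of this monomial in \<open>p\<close> to be 1.
\<close>

definition lowest :: "'k::comm_ring_1 infpoly \<Rightarrow> 'k infpoly \<Rightarrow> bool" where
  "lowest q p \<longleftrightarrow> (\<exists>m. q = Poly_Mapping.single m 1 \<and>
    (\<forall>n\<in>Poly_Mapping.keys (p - q). weight m < weight n))"

lemma lowest_refl: "lowest (Poly_Mapping.single m 1) (Poly_Mapping.single m 1)"
  by (auto simp: lowest_def)

text \<open>
  Writing \<open>p = q + r\<close> and \<open>p' = q' + r'\<close>, every monomial of \<open>p p' - q q' = r p' + q r'\<close>
  has a factor from \<open>r\<close> or \<open>r'\<close>, the other factor not lying below the lowest one, and so lies strictly above \<open>q q'\<close> by additivity of the weight.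
\<close>

lemma lowest_mult:
  assumes "lowest q p" "lowest q' p'"
  shows "lowest (q * q') (p * p')"
proof -
  obtain m where q: "q = Poly_Mapping.single m 1"
    and r: "\<And>n. n \<in> Poly_Mapping.keys (p - q) \<Longrightarrow> weight m < weight n"
    using assms(1) by (auto simp: lowest_def)
  obtain m' where q': "q' = Poly_Mapping.single m' 1"
    and r': "\<And>n. n \<in> Poly_Mapping.keys (p' - q') \<Longrightarrow> weight m' < weight n"
    using assms(2) by (auto simp: lowest_def)
  have p': "weight m' \<le> weight n" if "n \<in> Poly_Mapping.keys p'" for n
  proof (cases "n = m'")
    case False
    with that have "n \<in> Poly_Mapping.keys (p' - q')"
      by (simp add: q' in_keys_iff lookup_minus lookup_single)
    then show ?thesis using r' by force
  qed simp
  have "p * p' - q * q' = (p - q) * p' + q * (p' - q')"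
    by (simp add: algebra_simps)
  moreover have "weight (m + m') < weight n"
    if "n \<in> Poly_Mapping.keys ((p - q) * p' + q * (p' - q'))" for n
  proof -
    from that consider "n \<in> Poly_Mapping.keys ((p - q) * p')"
      | "n \<in> Poly_Mapping.keys (q * (p' - q'))"
      using keys_add[of "(p - q) * p'" "q * (p' - q')"] by blast
    then show ?thesis
    proof cases
      case 1
      then obtain b c where "n = b + c" "b \<in> Poly_Mapping.keys (p - q)"
        "c \<in> Poly_Mapping.keys p'"
        using keys_mult[of "p - q" p'] by blast
      with r p' show ?thesis by (simp add: weight_add add_less_le_mono)
    next
      case 2
      then obtain b c where "n = b + c" "b \<in> Poly_Mapping.keys q"
        "c \<in> Poly_Mapping.keys (p' - q')"
        using keys_mult[of q "p' - q'"] by blast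
      with r' show ?thesis by (simp add: q weight_add)
    qed
  qed
  ultimately show ?thesis
    unfolding lowest_def by (intro exI[of _ "m + m'"]) (simp add: q q' mult_single)
qed

lemma lowest_one: "lowest 1 1"
  using lowest_refl[of 0] by simp

lemma lowest_power: "lowest q p \<Longrightarrow> lowest (q ^ n) (p ^ n)"
  by (induction n) (simp_all add: lowest_one lowest_mult)

lemma lowest_prod: "(\<And>k. k \<in> A \<Longrightarrow> lowest (q k) (p k)) \<Longrightarrow> lowest (prod q A) (prod p A)"
  by (induction A rule: infinite_finite_induct) (simp_all add: lowest_one lowest_mult)

lemma lowest_Var: "lowest (Var k) (Var k)"
  unfolding Var_def by (rule lowest_refl)

lemma lowest_Var_add_Var:
  assumes "j < k"
  shows "lowest (Var j) (Var k + Var j)"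
  using assms unfolding lowest_def
  by (intro exI[of _ "Poly_Mapping.single j 1"]) (simp add: Var_def)

lemma lowest_imp_occurs:
  assumes "lowest q p"
  obtains m where "q = Poly_Mapping.single m 1" "m \<in> Poly_Mapping.keys p"
proof -
  from assms obtain m where q: "q = Poly_Mapping.single m 1"
    and r: "\<And>n. n \<in> Poly_Mapping.keys (p - q) \<Longrightarrow> weight m < weight n"
    by (auto simp: lowest_def)
  have "m \<notin> Poly_Mapping.keys (p - q)"
    using r by blast
  then have "m \<in> Poly_Mapping.keys p"
    by (auto simp: in_keys_iff q lookup_minus)
  with q show ?thesis by (rule that)
qed

text \<open>
  The polynomials all of whose monomials lie in a set \<open>B\<close> of monomials form a subspace
  containing \<open>B\<close>, hence containing the span of \<open>B\<close>.
\<close>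

lemma monomial_space_contains_monomials:
  fixes V :: "'k::field infpoly set"
  assumes "monomial_space V" "p \<in> V" "m \<in> Poly_Mapping.keys p"
  shows "Poly_Mapping.single m 1 \<in> V"
proof -
  obtain B where B: "B \<subseteq> monomials" "infpoly.span B = V"
    using assms(1) by (auto simp: monomial_space_def)
  let ?W = "{p :: 'k infpoly. \<forall>m\<in>Poly_Mapping.keys p. Poly_Mapping.single m 1 \<in> B}"
  have "infpoly.subspace ?W"
  proof (rule infpoly.subspaceI)
    fix p q :: "'k infpoly" assume "p \<in> ?W" "q \<in> ?W"
    then show "p + q \<in> ?W" using keys_add[of p q] by blast
  next
    fix c and p :: "'k infpoly" assume "p \<in> ?W"
    moreover have "Poly_Mapping.keys (scale c p) \<subseteq> Poly_Mapping.keys p"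
      using keys_mult[of "Const c" p]
      by (auto simp: scale_def Const_def split: if_splits)
    ultimately show "scale c p \<in> ?W" by blast
  qed simp
  moreover have "B \<subseteq> ?W"
    using B(1) by (auto simp: monomials_def)
  ultimately have "V \<subseteq> ?W"
    using B(2) infpoly.span_minimal by blast
  with assms(2,3) have "Poly_Mapping.single m 1 \<in> B" by blast
  then show ?thesis using B(2) infpoly.span_base by blast
qed

lemma subst_prod: "subst s (prod f A) = (\<Prod>k\<in>A. subst s (f k))"
  using subst_Const[of s 1]
  by (induction A rule: infinite_finite_induct) (simp_all add: subst_mult)

lemma subst_power: "subst s (p ^ n) = subst s p ^ n"
  using subst_prod[of s "\<lambda>_. p" "{..<n}"] by simp

definition block_shift :: "nat \<Rightarrow> nat \<Rightarrow> nat \<Rightarrow> 'k::comm_ring_1" where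
  "block_shift i l j = (if l = j \<or> i \<le> j \<and> Suc l = j then 1 else 0)"

lemma upper_unitriangular_block_shift: "upper_unitriangular (block_shift i)"
  by (auto simp: upper_unitriangular_def block_shift_def)

lemma act_block_shift_Var:
  assumes "i \<ge> 1"
  shows "act (block_shift i) (Var k) = (if k < i then Var k else Var k + Var (k - 1))"
proof (cases "k < i")
  case True
  then show ?thesis by (simp add: act_Var block_shift_def scale_def)
next
  case False
  have "(\<Sum>l<k. scale (block_shift i l k) (Var l :: 'a infpoly))
      = (\<Sum>l<k. if l = k - 1 then Var l else 0)"
    using assms False by (intro sum.cong) (auto simp: block_shift_def scale_def)
  also have "\<dots> = Var (k - 1)"
    using assms False by simp
  finally show ?thesis using False by (simp add: act_Var)
qed

theorem proposition2p14:
  fixes V :: "'k::field infpoly set"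
  assumes "monomial_space V" and "borel_fixed V"
  shows "block_stable V"
  unfolding block_stable_def
proof (intro allI impI ballI)
  fix a :: "nat \<Rightarrow> nat" and e i
  let ?u = "\<Prod>k\<le>e. Var k ^ a k :: 'k infpoly"
  let ?v = "(\<Prod>k<i. Var k ^ a k) * (\<Prod>k=i..e. Var (k - 1) ^ a k) :: 'k infpoly"
  let ?g = "block_shift i :: nat \<Rightarrow> nat \<Rightarrow> 'k"
  assume u: "?u \<in> V" and i: "i \<in> {1..e}"
  have split: "{..e} = {..<i} \<union> {i..e}"
    using i by auto
  have "?v = (\<Prod>k<i. (if k < i then Var k else Var (k - 1)) ^ a k) *
      (\<Prod>k=i..e. (if k < i then Var k else Var (k - 1)) ^ a k)"
    by simp
  also have "\<dots> = (\<Prod>k\<le>e. (if k < i then Var k else Var (k - 1)) ^ a k)"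
    unfolding split by (rule prod.union_disjoint[symmetric]) auto
  finally have v: "?v = (\<Prod>k\<le>e. (if k < i then Var k else Var (k - 1)) ^ a k)" .
  have "act ?g ?u = (\<Prod>k\<le>e. act ?g (Var k) ^ a k)"
    by (simp only: act_def subst_prod subst_power)
  moreover have "lowest (if k < i then Var k else Var (k - 1)) (act ?g (Var k))" for k
    using i by (simp add: act_block_shift_Var lowest_Var lowest_Var_add_Var)
  ultimately have "lowest ?v (act ?g ?u)"
    unfolding v by (simp only: lowest_prod lowest_power)
  then obtain m where m: "?v = Poly_Mapping.single m 1" "m \<in> Poly_Mapping.keys (act ?g ?u)"
    by (rule lowest_imp_occurs)
  have "act ?g ?u \<in> V"
    using assms(2) u upper_unitriangular_block_shift by (auto simp: borel_fixed_def)
  then show "?v \<in> V"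
    using monomial_space_contains_monomials[OF assms(1)] m by simp
qed

end
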